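(* Let $\Gamma$ be an arbitrary regular graph of degree $k\ge 2$ (not necessarily simple) with a distinguished vertex $o$, and let $\tilde\varrho=\tilde\varrho(\Gamma,o)$, $\gamma^*=\gamma^*(\Gamma,o)$. Then $$\gamma^*\le\frac{\tilde\varrho+\sqrt{\tilde\varrho^2-4(k-1)}}{2}.$$ If, in addition, $\tilde\varrho>2\sqrt{k-1}$ (e.g. when $\Gamma$ is vertex-transitive and simple and is not a tree), then the estimate becomes an identity: $$\gamma^*=\frac{\tilde\varrho+\sqrt{\tilde\varrho^2-4(k-1)}}{2}.$$
   Context: Graphs are undirected; a graph that is not simple may have loops and multiple edges (a loop counts twice towards the degree and can be traversed in two directions), while a simple graph has neither. A graph is vertex-transitive if its automorphism group acts transitively on its set of vertices. Paths may use vertices and edges more than once and, in graphs that are not simple, are regarded as sequences of edges, so two paths through the same vertices in the same order but through different edges are distinct. A cycle is a path whose start and end vertices coincide; it has a distinguished starting point and an orientation. For $n\in\mathbb{N}=\{0,1,2,\dots\}$: $C_n(\Gamma,o)$ is the number of oriented cycles of length $n$ in $\Gamma$ starting at $o$; $a^*_n(\Gamma,o)$ is the number of oriented cycles of length $n$ in $\Gamma$ starting at $o$ without backtracks, i.e. without pairs of consecutive passes through the same edge, forth and back (not regarded cyclically: passing through the same edge as the first and the last step is not a backtrack). Put $$\tilde\varrho(\Gamma,o)=\limsup_{n\to\infty}\sqrt[n]{C_n(\Gamma,o)},\qquad \gamma^*(\Gamma,o)=\limsup_{n\to\infty}\sqrt[n]{a^*_n(\Gamma,o)}.$$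
   Formalization: In the "e.g." parenthesis, "not a tree" is required of the connected component of o (it fails for disjoint unions of trees), and ϱ̃ > 2√(k−1) is claimed only for k ≥ 3 (finite cycle graphs, k = 2, have equality); the identity is still proved for k = 2. *)

theory Defs
  imports
    "Graph_Theory.Bidirected_Digraph"
    "Graph_Theory.Digraph_Isomorphism"
    "HOL-Library.Extended_Real"
begin

text \<open>
  A graph that may have loops and multiple edges is a \<^locale>\<open>bidirected_digraph\<close>: every
  undirected edge is a pair of mutually reverse arcs \<open>{a, arev a}\<close>, and \<open>arev\<close> has no fixed point
  on arcs. A loop therefore contributes two arcs, that is, it counts twice towards the degree and
  can be traversed in two directions. No finiteness is assumed.
\<close>

text \<open>For \<open>k > 0\<close> this includes local finiteness, since infinite sets have cardinality \<open>0\<close>.\<close>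

definition regular_graph :: "('a, 'b) pre_digraph \<Rightarrow> nat \<Rightarrow> bool" where
  "regular_graph G k \<longleftrightarrow> (\<forall>v\<in>verts G. out_degree G v = k)"

definition simple_graph :: "('a, 'b) pre_digraph \<Rightarrow> bool" where
  "simple_graph G \<longleftrightarrow> loopfree_digraph G \<and> nomulti_digraph G"

definition graph_automorphism ::
  "('a, 'b) pre_digraph \<Rightarrow> ('b \<Rightarrow> 'b) \<Rightarrow> ('a, 'b, 'a, 'b) digraph_isomorphism \<Rightarrow> bool" where
  "graph_automorphism G arev h \<longleftrightarrow>
     pre_digraph.digraph_isomorphism G h \<and> app_iso h G = G \<and>
     (\<forall>a\<in>arcs G. iso_arcs h (arev a) = arev (iso_arcs h a))"

definition vertex_transitive :: "('a, 'b) pre_digraph \<Rightarrow> ('b \<Rightarrow> 'b) \<Rightarrow> bool" where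
  "vertex_transitive G arev \<longleftrightarrow>
     (\<forall>u\<in>verts G. \<forall>v\<in>verts G. \<exists>h. graph_automorphism G arev h \<and> iso_verts h u = v)"

text \<open>
  The library's \<^const>\<open>forest\<close> and \<^const>\<open>tree\<close> are not usable here: traversing an edge forth and
  back is a directed cycle, so they would exclude every graph that has an edge. A circuit of an
  undirected graph must in addition never use an edge in both directions.
\<close>

definition circuit :: "('a, 'b) pre_digraph \<Rightarrow> ('b \<Rightarrow> 'b) \<Rightarrow> 'b list \<Rightarrow> bool" where
  "circuit G arev p \<longleftrightarrow> pre_digraph.cycle G p \<and> (\<forall>a\<in>set p. arev a \<notin> set p)"

definition undirected_tree :: "('a, 'b) pre_digraph \<Rightarrow> ('b \<Rightarrow> 'b) \<Rightarrow> bool" where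
  "undirected_tree G arev \<longleftrightarrow> Digraph_Component.connected G \<and> \<not> (\<exists>p. circuit G arev p)"

definition component_of :: "('a, 'b) pre_digraph \<Rightarrow> 'a \<Rightarrow> ('a, 'b) pre_digraph" where
  "component_of G v = G \<restriction> {u. v \<rightarrow>\<^sup>*\<^bsub>G\<^esub> u}"

definition closed_walks :: "('a, 'b) pre_digraph \<Rightarrow> 'a \<Rightarrow> nat \<Rightarrow> 'b list set" where
  "closed_walks G v n = {p. pre_digraph.awalk G v p v \<and> length p = n}"

text \<open>Not cyclic: the last and the first step are not compared.\<close>

definition no_backtrack :: "('b \<Rightarrow> 'b) \<Rightarrow> 'b list \<Rightarrow> bool" where
  "no_backtrack arev p \<longleftrightarrow> (\<forall>i. Suc i < length p \<longrightarrow> p ! Suc i \<noteq> arev (p ! i))"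

definition num_cycles :: "('a, 'b) pre_digraph \<Rightarrow> 'a \<Rightarrow> nat \<Rightarrow> nat" where
  "num_cycles G v n = card (closed_walks G v n)"

definition num_reduced_cycles ::
  "('a, 'b) pre_digraph \<Rightarrow> ('b \<Rightarrow> 'b) \<Rightarrow> 'a \<Rightarrow> nat \<Rightarrow> nat" where
  "num_reduced_cycles G arev v n = card {p \<in> closed_walks G v n. no_backtrack arev p}"

text \<open>
  The upper limit is taken in the extended reals. In a graph of degree \<open>k\<close> the counts above are at
  most \<open>k ^ n\<close>, so the limits are finite and lie between \<open>0\<close> and \<open>k\<close>.
\<close>

definition growth_rate :: "(nat \<Rightarrow> nat) \<Rightarrow> real" where
  "growth_rate c = real_of_ereal (limsup (\<lambda>n. ereal (root n (real (c n)))))"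

definition cycle_growth :: "('a, 'b) pre_digraph \<Rightarrow> 'a \<Rightarrow> real" where
  "cycle_growth G v = growth_rate (num_cycles G v)"

definition reduced_cycle_growth :: "('a, 'b) pre_digraph \<Rightarrow> ('b \<Rightarrow> 'b) \<Rightarrow> 'a \<Rightarrow> real" where
  "reduced_cycle_growth G arev v = growth_rate (num_reduced_cycles G arev v)"

end

theory Submission
  imports Defs "HOL-Library.Indicator_Function"
begin

text \<open>
  Put \<open>q = k - 1\<close>. Applying the adjacency operator to the end point of walks without backtracks
  of length \<open>m\<close> gives those of length \<open>m + 1\<close> and \<open>q\<close> times those of length \<open>m - 1\<close>
  (\<open>k\<close> times for \<open>m = 1\<close>), so the sphere sums \<open>x\<^sub>m\<close> of a function \<open>h\<close> with \<open>A h = w h\<close>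
  satisfy \<open>x\<^sub>m\<^sub>+\<^sub>1 + q x\<^sub>m\<^sub>-\<^sub>1 = w x\<^sub>m\<close>, with characteristic roots \<open>s\<close> and \<open>q / s\<close> if
  \<open>w = s + q / s\<close>. For \<open>w\<close> above the cycle growth the Green function is a nonnegative solution up
  to a source at the base point, whose sphere sums are the numbers \<open>a\<^sup>*\<^sub>m\<close>. Nonnegativity of \<open>x\<close>
  forces \<open>a\<^sup>*\<^sub>m = O(s\<^sup>m)\<close>, and it is impossible for \<open>w < 2 sqrt q\<close>. Conversely, \<open>C\<^sub>n\<close> is obtained
  from \<open>(a\<^sup>*\<^sub>m)\<close> by iterating the same recursion \<open>n\<close> times, and \<open>s\<^sup>m\<close> is a supersolution of it, so
  \<open>a\<^sup>*\<^sub>m = O(s\<^sup>m)\<close> with \<open>sqrt q < s\<close> gives \<open>C\<^sub>n = O(w\<^sup>n)\<close>.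
\<close>

section \<open>Second-order recurrence inequalities\<close>

lemma power_dominates:
  fixes a b c :: real
  assumes "1 < a" "0 < c"
  obtains n where "b < c * a ^ n"
proof -
  obtain n where "b / c < a ^ n"
    using real_arch_pow[OF assms(1)] by blast
  then have "b < c * a ^ n"
    using assms(2) by (simp add: field_simps)
  then show ?thesis by (rule that)
qed

text \<open>The characteristic roots are \<open>s\<close> and \<open>q / s < s\<close>. The difference
  \<open>x (Suc n) - q / s * x n\<close> grows at most by the factor \<open>s\<close> in each step, so once it is
  negative it drives \<open>x\<close> below zero.\<close>

context
  fixes x y :: "nat \<Rightarrow> real" and q s :: real
  assumes q: "0 < q" and s: "0 < s" "q < s\<^sup>2"
    and x: "\<And>n. 0 \<le> x n" and y: "\<And>n. 0 \<le> y n"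
    and rec: "\<And>n. x (n + 2) + q * x n + y n = (s + q / s) * x (n + 1)"
begin

lemma recurrence_defect_step:
  "x (n + 2) - q / s * x (n + 1) + y n = s * (x (n + 1) - q / s * x n)"
  using rec[of n] s by (simp add: algebra_simps)

lemma recurrence_defect_mono:
  "x (m + j + 1) - q / s * x (m + j) \<le> s ^ j * (x (m + 1) - q / s * x m)"
proof (induction j)
  case (Suc j)
  have "x (m + Suc j + 1) - q / s * x (m + Suc j) \<le> s * (x (m + j + 1) - q / s * x (m + j))"
    using recurrence_defect_step[of "m + j"] y[of "m + j"] by simp
  also have "\<dots> \<le> s * (s ^ j * (x (m + 1) - q / s * x m))"
    using Suc.IH s by (intro mult_left_mono) auto
  finally show ?case by (simp add: mult.assoc)
qed simp

lemma recurrence_defect_gap: "0 < s - q / s"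
  using s by (simp add: field_simps power2_eq_square)

text \<open>This solves the first-order inequality
  \<open>x (m + j + 1) \<le> t * x (m + j) + s ^ j * D\<close> from
  \<open>recurrence_defect_mono\<close>, with \<open>t = q / s\<close> and \<open>D\<close> the
  defect at \<open>m\<close>; \<open>D / (s - t)\<close> is the coefficient of \<open>s ^ j\<close>
  in the solution.\<close>

lemma recurrence_bound:
  "x (m + j) \<le> (q / s) ^ j * (x m - (x (m + 1) - q / s * x m) / (s - q / s))
    + s ^ j * ((x (m + 1) - q / s * x m) / (s - q / s))"
proof -
  define t where "t = q / s"
  define D where "D = x (m + 1) - t * x m"
  define E where "E = D / (s - t)"
  have gap: "0 < s - t"
    using recurrence_defect_gap by (simp add: t_def)
  have D: "D = (s - t) * E"
    using gap by (simp add: E_def)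
  have t: "0 \<le> t" using q s by (simp add: t_def)
  have "x (m + j) \<le> t ^ j * (x m - E) + s ^ j * E"
  proof (induction j)
    case (Suc j)
    have "x (m + Suc j) \<le> t * x (m + j) + s ^ j * D"
      using recurrence_defect_mono[of m j] by (simp add: t_def D_def)
    also have "\<dots> \<le> t * (t ^ j * (x m - E) + s ^ j * E) + s ^ j * D"
      using Suc.IH t by (intro add_right_mono mult_left_mono)
    also have "\<dots> = t ^ Suc j * (x m - E) + s ^ Suc j * E"
      unfolding D by (simp add: algebra_simps)
    finally show ?case .
  qed simp
  then show ?thesis
    by (simp add: t_def D_def E_def)
qed

lemma recurrence_defect_nonneg: "q / s * x m \<le> x (m + 1)"
proof (rule ccontr)
  define E where "E = (x (m + 1) - q / s * x m) / (s - q / s)"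
  assume "\<not> ?thesis"
  then have E: "E < 0"
    using recurrence_defect_gap by (simp add: E_def divide_neg_pos)
  have t: "0 < q / s" using q s by simp
  \<comment> \<open>As \<open>s\<close> exceeds \<open>q / s\<close>, the negative term
    \<open>s ^ j * E\<close> eventually outweighs the other one and the bound on
    \<open>x (m + j)\<close> becomes negative.\<close>
  have "1 < s / (q / s)"
    using s q by (simp add: field_simps power2_eq_square)
  then obtain j where "x m - E < - E * (s / (q / s)) ^ j"
    using power_dominates E by (metis neg_0_less_iff_less)
  then have "(q / s) ^ j * (x m - E) < (q / s) ^ j * (- E * (s / (q / s)) ^ j)"
    using t by (intro mult_strict_left_mono) auto
  also have "\<dots> = - (s ^ j * E)"
    using q s by (simp add: power_divide power_mult_distrib)
  finally show False
    using recurrence_bound[of m j] x[of "m + j"] by (simp add: E_def)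
qed

lemma recurrence_growth:
  obtains K where "0 < K" "\<And>n. x n \<le> K * s ^ n"
proof -
  define E where "E = (x 1 - q / s * x 0) / (s - q / s)"
  have E: "0 \<le> E"
    using recurrence_defect_nonneg[of 0] recurrence_defect_gap by (simp add: E_def)
  have "x n \<le> (x 0 + E + 1) * s ^ n" for n
  proof -
    have "q / s \<le> s" using recurrence_defect_gap by simp
    then have le: "(q / s) ^ n \<le> s ^ n"
      using q s by (intro power_mono) auto
    have "x n \<le> (q / s) ^ n * (x 0 - E) + s ^ n * E"
      using recurrence_bound[of 0 n] by (simp add: E_def)
    also have "\<dots> \<le> (q / s) ^ n * x 0 + s ^ n * E"
      using E q s by (intro add_right_mono mult_left_mono) auto
    also have "\<dots> \<le> s ^ n * x 0 + s ^ n * E"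
      using le x[of 0] by (intro add_right_mono mult_right_mono) auto
    also have "\<dots> \<le> (x 0 + E + 1) * s ^ n"
      using s by (simp add: algebra_simps)
    finally show ?thesis .
  qed
  with x[of 0] E show ?thesis by (intro that[of "x 0 + E + 1"]) auto
qed

text \<open>The next defect is still nonnegative, so \<open>y n\<close> is at most \<open>s\<close>
  times the defect at \<open>n\<close>, which is \<open>O(s ^ n)\<close>.\<close>

lemma recurrence_source_growth:
  obtains K where "0 < K" "\<And>n. y n \<le> K * s ^ n"
proof -
  define D where "D = x 1 - q / s * x 0"
  have D: "0 \<le> D"
    using recurrence_defect_nonneg[of 0] by (simp add: D_def)
  have "y n \<le> (s * D + 1) * s ^ n" for n
  proof -
    have "y n \<le> s * (x (n + 1) - q / s * x n)"
      using recurrence_defect_step[of n] recurrence_defect_nonneg[of "n + 1"] by simp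
    also have "\<dots> \<le> s * (s ^ n * D)"
      using recurrence_defect_mono[of 0 n] s by (intro mult_left_mono) (auto simp: D_def)
    also have "\<dots> \<le> (s * D + 1) * s ^ n"
      using s by (simp add: algebra_simps)
    finally show ?thesis .
  qed
  with D s show ?thesis by (intro that[of "s * D + 1"]) (auto intro: add_nonneg_pos)
qed

end

text \<open>Below the critical value \<open>2 * sqrt q\<close> the ratio of consecutive terms would decrease by at
  least \<open>2 * sqrt q - w\<close> in each step.\<close>

lemma subcritical_recurrence_impossible:
  fixes x :: "nat \<Rightarrow> real" and q w :: real
  assumes q: "0 < q" and w: "w < 2 * sqrt q"
    and x: "\<And>n. 0 \<le> x n" and x0: "0 < x 0"
    and rec: "\<And>n. x (n + 2) + q * x n \<le> w * x (n + 1)"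
  shows False
proof -
  \<comment> \<open>If \<open>x n > 0\<close>, the recurrence makes \<open>w * x (n + 1)\<close>
    positive, so \<open>x (n + 1)\<close> cannot vanish.\<close>
  have pos: "0 < x n" for n
  proof (induction n)
    case (Suc n)
    have "0 < w * x (n + 1)"
      using rec[of n] x[of "n + 2"] mult_pos_pos[OF q Suc.IH] by linarith
    with x[of "n + 1"] show ?case
      by (metis Suc_eq_plus1 less_eq_real_def mult_zero_right)
  qed (rule x0)
  define r where "r n = x (n + 1) / x n" for n
  have r: "0 < r n" for n using pos by (simp add: r_def)
  have step: "r (Suc n) \<le> r n - (2 * sqrt q - w)" for n
  proof -
    have "r (Suc n) + q / r n = (x (n + 2) + q * x n) / x (n + 1)"
      using pos[of n] pos[of "n + 1"] by (simp add: r_def field_simps)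
    also have "\<dots> \<le> w"
      using rec[of n] pos[of "n + 1"] by (simp add: field_simps)
    finally have 1: "r (Suc n) + q / r n \<le> w" .
    \<comment> \<open>The square yields \<open>2 * sqrt q \<le> r n + q / r n\<close>, which turns
      the bound on \<open>r (Suc n) + q / r n\<close> into a fixed decrease of the ratio.\<close>
    have "0 \<le> (r n - sqrt q)\<^sup>2" by simp
    then have "2 * sqrt q * r n \<le> (r n)\<^sup>2 + q"
      using q by (simp add: power2_diff algebra_simps)
    then have "2 * sqrt q \<le> r n + q / r n"
      using r[of n] by (simp add: field_simps power2_eq_square)
    with 1 show ?thesis by linarith
  qed
  have "r n \<le> r 0 - real n * (2 * sqrt q - w)" for n
  proof (induction n)
    case (Suc n)
    then show ?case using step[of n] by (simp add: algebra_simps)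
  qed simp
  moreover obtain n where "r 0 < real n * (2 * sqrt q - w)"
    using reals_Archimedean3[of "2 * sqrt q - w"] w by auto
  ultimately show False using r[of n] by (metis diff_less_0_iff_less not_less less_imp_le order.strict_trans2)
qed

section \<open>Growth rates\<close>

lemma limsup_root_nonneg: "0 \<le> limsup (\<lambda>n. ereal (root n (real (c n))))"
  by (rule le_Limsup) (auto intro!: always_eventually simp: real_root_ge_zero)

text \<open>The constant factor disappears because \<open>root n K\<close> tends to 1.\<close>

lemma growth_rate_le:
  assumes "0 \<le> w" "\<And>n. real (c n) \<le> K * w ^ n" "0 < K"
  shows "growth_rate c \<le> w"
proof -
  have bound: "root n (real (c n)) \<le> root n K * w" if "0 < n" for n
  proof -
    have "root n (real (c n)) \<le> root n (K * w ^ n)"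
      using that assms(2) by simp
    also have "\<dots> = root n K * w"
      using that assms by (simp add: real_root_mult real_root_power_cancel)
    finally show ?thesis .
  qed
  have "(\<lambda>n. root n K * w) \<longlonglongrightarrow> 1 * w"
    by (intro tendsto_mult LIMSEQ_root_const assms tendsto_const)
  then have lim: "limsup (\<lambda>n. ereal (root n K * w)) = ereal w"
    by (intro lim_imp_Limsup) auto
  have "limsup (\<lambda>n. ereal (root n (real (c n)))) \<le> ereal w"
    unfolding lim[symmetric]
    by (rule Limsup_mono) (use bound in \<open>auto intro!: eventually_sequentiallyI[of 1]\<close>)
  moreover note limsup_root_nonneg[of c]
  ultimately show ?thesis
    unfolding growth_rate_def by (cases "limsup (\<lambda>n. ereal (root n (real (c n))))") auto
qed

lemma growth_rate_nonneg: "0 \<le> growth_rate c"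
  using limsup_root_nonneg[of c] unfolding growth_rate_def by (simp add: real_of_ereal_pos)

text \<open>The exponential bound on \<open>c\<close> is needed since \<open>real_of_ereal \<infinity> = 0\<close>.\<close>

lemma growth_rate_lessD:
  assumes "growth_rate c < w" and exp: "\<And>n. real (c n) \<le> b ^ n" and b: "0 \<le> b"
  obtains K where "0 < K" "\<And>n. real (c n) \<le> K * w ^ n"
proof -
  have w: "0 < w"
    using assms(1) growth_rate_nonneg[of c] by linarith
  let ?L = "limsup (\<lambda>n. ereal (root n (real (c n))))"
  have "root n (real (c n)) \<le> b" if "0 < n" for n
  proof -
    have "root n (real (c n)) \<le> root n (b ^ n)"
      using that exp by simp
    with that b show ?thesis by (simp add: real_root_power_cancel)
  qed
  then have "?L \<le> ereal b"
    by (intro Limsup_bounded) (auto intro!: eventually_sequentiallyI[of 1])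
  moreover note limsup_root_nonneg[of c]
  ultimately have "?L = ereal (growth_rate c)"
    unfolding growth_rate_def by (cases ?L) auto
  with assms(1) have "?L < ereal w" by simp
  then have "\<forall>\<^sub>F n in sequentially. ereal (root n (real (c n))) < ereal w"
    by (rule Limsup_lessD)
  then obtain N where N: "\<And>n. N \<le> n \<Longrightarrow> root n (real (c n)) < w"
    by (auto simp: eventually_sequentially)
  \<comment> \<open>The sum absorbs the finitely many \<open>n \<le> N\<close>; the summand
    \<open>1\<close> covers the tail.\<close>
  define K where "K = 1 + (\<Sum>n\<le>N. real (c n) / w ^ n)"
  have K: "1 \<le> K"
    unfolding K_def using w by (simp add: sum_nonneg)
  have "real (c n) \<le> K * w ^ n" for n
  proof (cases "n \<le> N")
    case True
    have "real (c n) / w ^ n \<le> (\<Sum>n\<le>N. real (c n) / w ^ n)"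
      using True w by (intro member_le_sum) auto
    then have "real (c n) / w ^ n \<le> K" by (simp add: K_def)
    then show ?thesis using w by (simp add: field_simps)
  next
    case False
    then have "real (c n) = root n (real (c n)) ^ n" by simp
    also have "\<dots> \<le> w ^ n"
      using N[of n] False by (intro power_mono) auto
    also have "\<dots> \<le> K * w ^ n"
      using K w by simp
    finally show ?thesis .
  qed
  with K show ?thesis by (intro that[of K]) auto
qed

section \<open>Walk operators on regular graphs\<close>

lemma no_backtrack_successively: "no_backtrack arev p \<longleftrightarrow> successively (\<lambda>a b. b \<noteq> arev a) p"
  by (auto simp: no_backtrack_def successively_conv_nth)

text \<open>Walks with different first arcs are distinct, so the counts of walks below become sums
  over the first arc.\<close>

lemma card_UN_Cons:
  assumes "finite E" "\<And>e. e \<in> E \<Longrightarrow> finite (W e)"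
  shows "finite (\<Union>e\<in>E. (#) e ` W e)"
    and "card (\<Union>e\<in>E. (#) e ` W e) = (\<Sum>e\<in>E. card (W e))"
proof -
  show "finite (\<Union>e\<in>E. (#) e ` W e)"
    using assms by auto
  have "card (\<Union>e\<in>E. (#) e ` W e) = (\<Sum>e\<in>E. card ((#) e ` W e))"
    using assms by (intro card_UN_disjoint) auto
  also have "\<dots> = (\<Sum>e\<in>E. card (W e))"
    by (intro sum.cong) (auto simp: card_image)
  finally show "card (\<Union>e\<in>E. (#) e ` W e) = (\<Sum>e\<in>E. card (W e))" .
qed

text \<open>\<open>q\<close> is the degree minus one, the number of ways to go on from an arc
  without a backtrack. The positive cardinality also makes the sets of outgoing arcs finite.\<close>

locale regular_bidirected_digraph = bidirected_digraph G arev
  for G :: "('a, 'b) pre_digraph" and arev :: "'b \<Rightarrow> 'b" +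
  fixes q :: nat
  assumes q_pos: "0 < q"
    and card_out_arcs: "v \<in> verts G \<Longrightarrow> card (out_arcs G v) = Suc q"
begin

definition adj :: "('a \<Rightarrow> real) \<Rightarrow> 'a \<Rightarrow> real" where
  "adj f v = (\<Sum>e\<in>out_arcs G v. f (head G e))"

definition continuations :: "'b \<Rightarrow> 'b set" where
  "continuations a = out_arcs G (head G a) - {arev a}"

text \<open>\<open>branch f n a\<close> sums \<open>f\<close> over the end points of the extensions of the arc \<open>a\<close> by \<open>n\<close> further
  arcs without backtracks, and \<open>sphere f n v\<close> over the end points of the walks of length \<open>n\<close> from
  \<open>v\<close> without backtracks. If \<open>f\<close> is the indicator of \<open>v\<close>, then \<open>(adj ^^ n) f v\<close> and
  \<open>sphere f n v\<close> are the numbers \<open>C\<^sub>n\<close> and \<open>a\<^sup>*\<^sub>n\<close>.\<close>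

primrec branch :: "('a \<Rightarrow> real) \<Rightarrow> nat \<Rightarrow> 'b \<Rightarrow> real" where
  "branch f 0 a = f (head G a)"
| "branch f (Suc n) a = (\<Sum>b\<in>continuations a. branch f n b)"

primrec sphere :: "('a \<Rightarrow> real) \<Rightarrow> nat \<Rightarrow> 'a \<Rightarrow> real" where
  "sphere f 0 v = f v"
| "sphere f (Suc n) v = (\<Sum>a\<in>out_arcs G v. branch f n a)"

lemma finite_out_arcs_vert [simp]: "v \<in> verts G \<Longrightarrow> finite (out_arcs G v)"
  using card_out_arcs[of v] card.infinite by fastforce

lemma continuationsD:
  assumes "a \<in> arcs G" "b \<in> continuations a"
  shows "b \<in> arcs G" "tail G b = head G a" "b \<noteq> arev a"
  using assms by (auto simp: continuations_def)

lemma finite_continuations [simp]: "a \<in> arcs G \<Longrightarrow> finite (continuations a)"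
  by (simp add: continuations_def)

lemma arev_out_arcs: "a \<in> arcs G \<Longrightarrow> arev a \<in> out_arcs G (head G a)"
  by simp

lemma card_continuations [simp]: "a \<in> arcs G \<Longrightarrow> card (continuations a) = q"
  unfolding continuations_def by (subst card_Diff_singleton) (auto simp: card_out_arcs)

text \<open>Among the arcs leaving \<open>head G a\<close>, only \<open>arev a\<close> is not a
  continuation, and it leads back to \<open>tail G a\<close>.\<close>

lemma adj_head:
  assumes "a \<in> arcs G"
  shows "adj f (head G a) = (\<Sum>b\<in>continuations a. f (head G b)) + f (tail G a)"
  using assms arev_out_arcs[OF assms]
  unfolding adj_def continuations_def by (subst sum.remove[of _ "arev a"]) auto

lemma branch_adj_0: "a \<in> arcs G \<Longrightarrow> branch (adj f) 0 a = branch f 1 a + f (tail G a)"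
  by (simp add: adj_head)

text \<open>A step from the end point either prolongs the walk or undoes its last arc; undoing
  yields each walk that is one arc shorter \<open>q\<close> times.\<close>

lemma branch_adj_Suc:
  "a \<in> arcs G \<Longrightarrow> branch (adj f) (Suc n) a = branch f (n + 2) a + real q * branch f n a"
proof (induction n arbitrary: a)
  case 0
  have "branch (adj f) (Suc 0) a = (\<Sum>b\<in>continuations a. branch f 1 b + f (tail G b))"
    using 0 by (auto simp: adj_head dest: continuationsD intro!: sum.cong)
  also have "\<dots> = (\<Sum>b\<in>continuations a. branch f 1 b + f (head G a))"
    using 0 by (auto dest: continuationsD intro!: sum.cong)
  also have "\<dots> = branch f 2 a + real q * branch f 0 a"
    using 0 by (simp add: sum.distrib numeral_2_eq_2)
  finally show ?case by (simp add: numeral_2_eq_2)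
next
  case (Suc n)
  have "branch (adj f) (Suc (Suc n)) a
      = (\<Sum>b\<in>continuations a. branch f (n + 2) b + real q * branch f n b)"
    unfolding branch.simps(2)[of _ "Suc n"]
    using Suc by (intro sum.cong refl) (auto dest: continuationsD simp del: branch.simps)
  then show ?case
    by (simp add: sum.distrib sum_distrib_left)
qed

lemma sphere_adj_0: "sphere (adj f) 0 v = sphere f 1 v"
  by (simp add: adj_def)

text \<open>Each of the \<open>q + 1\<close> arcs leaving \<open>v\<close> can be undone, hence a
  factor \<open>q + 1\<close> instead of \<open>q\<close>.\<close>

lemma sphere_adj_1:
  assumes "v \<in> verts G"
  shows "sphere (adj f) 1 v = sphere f 2 v + (real q + 1) * f v"
proof -
  have "sphere (adj f) 1 v = (\<Sum>a\<in>out_arcs G v. branch f 1 a + f v)"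
    by (auto simp: adj_head intro!: sum.cong)
  then show ?thesis
    using assms by (simp add: sum.distrib card_out_arcs numeral_2_eq_2 algebra_simps)
qed

lemma sphere_adj_Suc_Suc:
  "sphere (adj f) (n + 2) v = sphere f (n + 3) v + real q * sphere f (n + 1) v"
proof -
  have "sphere (adj f) (n + 2) v = (\<Sum>a\<in>out_arcs G v. branch f (n + 2) a + real q * branch f n a)"
    using branch_adj_Suc by (auto simp del: branch.simps intro!: sum.cong)
  then show ?thesis
    by (simp add: sum.distrib sum_distrib_left numeral_3_eq_3)
qed

lemma adj_mono:
  assumes "v \<in> verts G" "\<And>u. u \<in> verts G \<Longrightarrow> f u \<le> g u"
  shows "adj f v \<le> adj g v"
  unfolding adj_def using assms by (intro sum_mono) auto

lemma branch_mono:
  assumes "\<And>v. v \<in> verts G \<Longrightarrow> f v \<le> g v" "a \<in> arcs G"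
  shows "branch f n a \<le> branch g n a"
  using assms(2)
proof (induction n arbitrary: a)
  case (Suc n)
  then show ?case by (auto intro!: sum_mono dest: continuationsD)
qed (use assms(1) in auto)

lemma branch_cong:
  assumes "\<And>v. v \<in> verts G \<Longrightarrow> f v = g v" "a \<in> arcs G"
  shows "branch f n a = branch g n a"
  using assms by (intro antisym branch_mono) auto

lemma branch_zero: "branch (\<lambda>_. 0) n a = 0"
  by (induction n arbitrary: a) auto

lemma branch_nonneg:
  assumes "\<And>v. v \<in> verts G \<Longrightarrow> 0 \<le> f v" "a \<in> arcs G"
  shows "0 \<le> branch f n a"
  using branch_mono[of "\<lambda>_. 0" f a n] assms by (simp add: branch_zero)

lemma branch_diff_scaled:
  "branch (\<lambda>v. c * f v - c * g v) n a = c * branch f n a - c * branch g n a"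
  by (induction n arbitrary: a) (simp_all add: sum_subtractf sum_distrib_left)

lemma sphere_nonneg:
  assumes "\<And>v. v \<in> verts G \<Longrightarrow> 0 \<le> f v" "v \<in> verts G"
  shows "0 \<le> sphere f n v"
  using assms by (cases n) (auto intro!: sum_nonneg branch_nonneg)

lemma adj_power_bounds:
  assumes "v \<in> verts G"
  shows "0 \<le> (adj ^^ n) (indicator {u}) v" "(adj ^^ n) (indicator {u}) v \<le> (real q + 1) ^ n"
proof -
  have "0 \<le> (adj ^^ n) (indicator {u}) v \<and> (adj ^^ n) (indicator {u}) v \<le> (real q + 1) ^ n"
    using assms
  proof (induction n arbitrary: v)
    case (Suc n)
    have "adj (\<lambda>_. 0) v \<le> adj ((adj ^^ n) (indicator {u})) v"
      using Suc by (intro adj_mono) auto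
    moreover have "adj ((adj ^^ n) (indicator {u})) v \<le> adj (\<lambda>_. (real q + 1) ^ n) v"
      using Suc by (intro adj_mono) auto
    ultimately show ?case
      using Suc.prems by (simp add: adj_def[of "\<lambda>_. _"] card_out_arcs add.commute)
  qed (auto simp: indicator_def)
  then show "0 \<le> (adj ^^ n) (indicator {u}) v" "(adj ^^ n) (indicator {u}) v \<le> (real q + 1) ^ n"
    by auto
qed

section \<open>Counting walks by their first arc\<close>

lemma card_walks:
  assumes "v \<in> verts G"
  shows "finite {p. awalk v p u \<and> length p = n}"
    and "real (card {p. awalk v p u \<and> length p = n}) = (adj ^^ n) (indicator {u}) v"
proof -
  have "finite {p. awalk v p u \<and> length p = n} \<and>
      real (card {p. awalk v p u \<and> length p = n}) = (adj ^^ n) (indicator {u}) v"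
    using assms
  proof (induction n arbitrary: v)
    case 0
    have "{p. awalk v p u \<and> length p = 0} = (if v = u then {[]} else {})"
      using 0 by (auto simp: awalk_Nil_iff)
    then show ?case by (simp add: indicator_def)
  next
    case (Suc n)
    let ?W = "\<lambda>e. {p. awalk (head G e) p u \<and> length p = n}"
    have eq: "{p. awalk v p u \<and> length p = Suc n} = (\<Union>e\<in>out_arcs G v. (#) e ` ?W e)"
      by (auto simp: length_Suc_conv awalk_Cons_iff)
    have fin: "finite (?W e)" "real (card (?W e)) = (adj ^^ n) (indicator {u}) (head G e)"
      if "e \<in> out_arcs G v" for e
      using Suc.IH[of "head G e"] that by auto
    show ?case
      unfolding eq using card_UN_Cons[of "out_arcs G v" ?W] fin Suc.prems
      by (simp add: adj_def[of "(adj ^^ n) _"] del: in_out_arcs_conv cong: sum.cong)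
  qed
  then show "finite {p. awalk v p u \<and> length p = n}"
    and "real (card {p. awalk v p u \<and> length p = n}) = (adj ^^ n) (indicator {u}) v"
    by auto
qed

text \<open>Keeping the previous arc \<open>a\<close> in the condition tests the first step of
  \<open>p\<close> too, and the recursion over \<open>continuations\<close> closes.\<close>

lemma card_reduced_extensions:
  assumes "a \<in> arcs G"
  shows "finite {p. awalk (head G a) p u \<and> length p = n \<and> no_backtrack arev (a # p)}"
    and "real (card {p. awalk (head G a) p u \<and> length p = n \<and> no_backtrack arev (a # p)})
      = branch (indicator {u}) n a"
proof -
  let ?W = "\<lambda>n a. {p. awalk (head G a) p u \<and> length p = n \<and> no_backtrack arev (a # p)}"
  have "finite (?W n a) \<and> real (card (?W n a)) = branch (indicator {u}) n a"
    using assms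
  proof (induction n arbitrary: a)
    case 0
    have "?W 0 a = (if head G a = u then {[]} else {})"
      using 0 by (auto simp: awalk_Nil_iff no_backtrack_def)
    then show ?case by (simp add: indicator_def)
  next
    case (Suc n)
    have eq: "?W (Suc n) a = (\<Union>e\<in>continuations a. (#) e ` ?W n e)"
      by (auto simp: length_Suc_conv awalk_Cons_iff no_backtrack_successively continuations_def)
    have "finite (?W n e)" "real (card (?W n e)) = branch (indicator {u}) n e"
      if "e \<in> continuations a" for e
      using Suc.IH[of e] that Suc.prems by (auto dest: continuationsD)
    then show ?case
      unfolding eq using card_UN_Cons[of "continuations a" "?W n"] Suc.prems
      by (simp cong: sum.cong)
  qed
  then show "finite (?W n a)" "real (card (?W n a)) = branch (indicator {u}) n a"
    by auto
qed

lemma num_cycles_eq: "v \<in> verts G \<Longrightarrow> real (num_cycles G v n) = (adj ^^ n) (indicator {v}) v"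
  unfolding num_cycles_def closed_walks_def by (rule card_walks)

lemma num_cycles_le: "v \<in> verts G \<Longrightarrow> real (num_cycles G v n) \<le> (real q + 1) ^ n"
  using adj_power_bounds(2)[of v n v] num_cycles_eq[of v n] by simp

lemma num_reduced_cycles_le:
  "v \<in> verts G \<Longrightarrow> real (num_reduced_cycles G arev v n) \<le> (real q + 1) ^ n"
proof -
  assume v: "v \<in> verts G"
  have "num_reduced_cycles G arev v n \<le> num_cycles G v n"
    unfolding num_reduced_cycles_def num_cycles_def closed_walks_def
    using card_walks(1)[OF v] by (intro card_mono) auto
  then show ?thesis using num_cycles_le[OF v, of n] by linarith
qed

lemma num_reduced_cycles_eq:
  assumes v: "v \<in> verts G"
  shows "real (num_reduced_cycles G arev v n) = sphere (indicator {v}) n v"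
proof (cases n)
  case 0
  have "{p \<in> closed_walks G v 0. no_backtrack arev p} = {[]}"
    using v by (auto simp: closed_walks_def awalk_Nil_iff no_backtrack_def)
  with 0 show ?thesis by (simp add: num_reduced_cycles_def indicator_def)
next
  case (Suc m)
  let ?W = "\<lambda>a. {p. awalk (head G a) p v \<and> length p = m \<and> no_backtrack arev (a # p)}"
  have eq: "{p \<in> closed_walks G v n. no_backtrack arev p} = (\<Union>e\<in>out_arcs G v. (#) e ` ?W e)"
    by (auto simp: Suc closed_walks_def length_Suc_conv awalk_Cons_iff image_iff)
  have fin: "finite (?W e)" "real (card (?W e)) = branch (indicator {v}) m e"
    if "e \<in> out_arcs G v" for e
    using card_reduced_extensions[of e v m] that by auto
  show ?thesis
    unfolding num_reduced_cycles_def eq using card_UN_Cons[of "out_arcs G v" ?W] fin v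
    by (simp add: Suc del: in_out_arcs_conv cong: sum.cong)
qed

end

section \<open>Green functions\<close>

context regular_bidirected_digraph
begin

text \<open>\<open>h v\<close> is the sum of \<open>(adj ^^ n) (indicator {r}) v / w ^ n\<close>.
  Convergence is assumed at \<open>r\<close> only; it passes to neighbours and, arcs being
  reversible, so does divergence. The value 0 at divergent vertices therefore satisfies the
  equation.\<close>

lemma green_function_exists:
  assumes r: "r \<in> verts G" and w: "0 < w"
    and summable: "summable (\<lambda>n. (adj ^^ n) (indicator {r}) r / w ^ n)"
  obtains h where "\<And>v. v \<in> verts G \<Longrightarrow> 0 \<le> h v"
    and "\<And>v. v \<in> verts G \<Longrightarrow> w * h v = w * indicator {r} v + adj h v"
    and "0 < h r"
proof -
  define P where "P n = (adj ^^ n) (indicator {r})" for n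
  define S where "S v \<longleftrightarrow> summable (\<lambda>n. P n v / w ^ n)" for v
  define h where "h v = (if S v then \<Sum>n. P n v / w ^ n else 0)" for v
  have P_Suc: "P (Suc n) v = (\<Sum>e\<in>out_arcs G v. P n (head G e))" for n v
    by (simp add: P_def adj_def[of "(adj ^^ n) (indicator {r})"])
  have P_nonneg: "0 \<le> P n v" if "v \<in> verts G" for n v
    using adj_power_bounds(1)[OF that] by (simp add: P_def)
  have h_nonneg: "0 \<le> h v" if "v \<in> verts G" for v
    using P_nonneg[OF that] w by (auto simp: h_def S_def intro!: suminf_nonneg)
  have S_head: "S (head G e)" if "S v" "v \<in> verts G" "e \<in> out_arcs G v" for v e
  proof -
    have "summable (\<lambda>n. P (Suc n) v / w ^ Suc n)"
      using that(1) unfolding S_def by (subst summable_Suc_iff)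
    then have "summable (\<lambda>n. w * (P (Suc n) v / w ^ Suc n))"
      by (rule summable_mult)
    moreover have "norm (P n (head G e) / w ^ n) \<le> w * (P (Suc n) v / w ^ Suc n)" for n
    proof -
      have "P n (head G e) \<le> P (Suc n) v"
        unfolding P_Suc using that by (intro member_le_sum) (auto intro: P_nonneg)
      then show ?thesis
        using w P_nonneg[of "head G e" n] that by (simp add: divide_right_mono)
    qed
    ultimately show ?thesis
      unfolding S_def by (rule summable_comparison_test'[where N = 0])
  qed
  have eq: "w * h v = w * indicator {r} v + adj h v" if v: "v \<in> verts G" for v
  proof (cases "S v")
    case True
    have "(\<lambda>n. P n (head G e) / w ^ n) sums h (head G e)" if "e \<in> out_arcs G v" for e
      using S_head[OF True v that] unfolding h_def S_def by (simp add: summable_sums)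
    then have "(\<lambda>n. \<Sum>e\<in>out_arcs G v. P n (head G e) / w ^ n) sums adj h v"
      unfolding adj_def by (intro sums_sum)
    then have "(\<lambda>n. (\<Sum>e\<in>out_arcs G v. P n (head G e) / w ^ n) / w) sums (adj h v / w)"
      by (rule sums_divide)
    then have "(\<lambda>n. P (Suc n) v / w ^ Suc n) sums (adj h v / w)"
      by (simp add: P_Suc sum_divide_distrib mult.commute)
    then have "(\<lambda>n. P n v / w ^ n) sums (adj h v / w + P 0 v / w ^ 0)"
      by (rule sums_Suc)
    then have "h v = adj h v / w + indicator {r} v"
      using True by (simp add: h_def sums_iff P_def)
    then show ?thesis
      using w by (simp add: field_simps)
  next
    case False
    have "h (head G e) = 0" if "e \<in> out_arcs G v" for e
    proof -
      have "\<not> S (head G e)"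
        using S_head[of "head G e" "arev e"] that False by auto
      then show ?thesis by (simp add: h_def)
    qed
    then have "adj h v = 0" by (simp add: adj_def)
    moreover have "v \<noteq> r"
      using False summable by (auto simp: S_def P_def)
    ultimately show ?thesis
      using False by (simp add: h_def)
  qed
  have "0 \<le> adj h r"
    unfolding adj_def using h_nonneg by (intro sum_nonneg) auto
  with eq[OF r] w have "0 < w * h r" by simp
  with w have "0 < h r" by (simp add: zero_less_mult_iff)
  with h_nonneg eq show ?thesis by (rule that)
qed

text \<open>A number \<open>u\<close> strictly between the growth and \<open>w\<close> gives a
  geometric majorant of ratio \<open>u / w < 1\<close>.\<close>

lemma green_function_above_growth:
  assumes r: "r \<in> verts G" and w: "cycle_growth G r < w"
  obtains h where "\<And>v. v \<in> verts G \<Longrightarrow> 0 \<le> h v"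
    and "\<And>v. v \<in> verts G \<Longrightarrow> w * h v = w * indicator {r} v + adj h v"
    and "0 < h r"
proof -
  obtain u where u: "cycle_growth G r < u" "u < w"
    using dense[OF w] by blast
  have pos: "0 < u" "0 < w"
    using u growth_rate_nonneg[of "num_cycles G r"] by (auto simp: cycle_growth_def)
  obtain K where K: "0 < K" "\<And>n. real (num_cycles G r n) \<le> K * u ^ n"
    using growth_rate_lessD[of "num_cycles G r" u "real q + 1"] u num_cycles_le[OF r]
    by (auto simp: cycle_growth_def)
  have "summable (\<lambda>n. K * (u / w) ^ n)"
    using pos u by (intro summable_mult summable_geometric) auto
  moreover have "norm ((adj ^^ n) (indicator {r}) r / w ^ n) \<le> K * (u / w) ^ n" for n
    using K(2)[of n] pos adj_power_bounds(1)[OF r, of n r]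
    by (simp add: num_cycles_eq[OF r] power_divide divide_right_mono)
  ultimately have "summable (\<lambda>n. (adj ^^ n) (indicator {r}) r / w ^ n)"
    by (rule summable_comparison_test'[where N = 0])
  then show ?thesis
    using green_function_exists[OF r pos(2)] that by blast
qed

context
  fixes h :: "'a \<Rightarrow> real" and r :: 'a and w :: real
  assumes green: "\<And>v. v \<in> verts G \<Longrightarrow> w * h v = w * indicator {r} v + adj h v"
begin

lemma branch_green_0:
  "a \<in> arcs G \<Longrightarrow> branch h 1 a + h (tail G a) + w * indicator {r} (head G a) = w * h (head G a)"
  using green[of "head G a"] branch_adj_0[of a h] by simp

text \<open>Branch sums of both sides of the Green equation obey the recurrence of the first
  section, with the indicator of \<open>r\<close> as source.\<close>

lemma branch_green_Suc:
  assumes a: "a \<in> arcs G"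
  shows "branch h (n + 2) a + real q * branch h n a + w * branch (indicator {r}) (n + 1) a
    = w * branch h (n + 1) a"
proof -
  have "branch (adj h) (Suc n) a = branch (\<lambda>v. w * h v - w * indicator {r} v) (Suc n) a"
    using green by (intro branch_cong a) auto
  then show ?thesis
    using branch_adj_Suc[OF a, of h n] by (simp add: branch_diff_scaled del: branch.simps)
qed

end

section \<open>Comparison of the two growth rates\<close>

lemma indicator_branch_nonneg: "a \<in> arcs G \<Longrightarrow> 0 \<le> branch (indicator {r}) n a"
  by (rule branch_nonneg) auto

lemma ex_arc_to:
  assumes "v \<in> verts G"
  obtains a where "a \<in> arcs G" "head G a = v"
proof -
  have "out_arcs G v \<noteq> {}"
    using card_out_arcs[OF assms] by auto
  then obtain e where "e \<in> out_arcs G v" by blast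
  then show ?thesis by (intro that[of "arev e"]) auto
qed

lemma cycle_growth_ge:
  assumes r: "r \<in> verts G"
  shows "2 * sqrt (real q) \<le> cycle_growth G r"
proof (rule ccontr)
  assume "\<not> ?thesis"
  then obtain w where w: "cycle_growth G r < w" "w < 2 * sqrt (real q)"
    using dense by (metis not_le)
  have w0: "0 < w"
    using w(1) growth_rate_nonneg[of "num_cycles G r"] by (simp add: cycle_growth_def)
  obtain h where h: "\<And>v. v \<in> verts G \<Longrightarrow> 0 \<le> h v"
      "\<And>v. v \<in> verts G \<Longrightarrow> w * h v = w * indicator {r} v + adj h v" "0 < h r"
    using green_function_above_growth[OF r w(1)] by blast
  \<comment> \<open>An arc into \<open>r\<close> makes the branch sums start at
    \<open>h r > 0\<close>, as the subcritical argument requires.\<close>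
  obtain a where a: "a \<in> arcs G" "head G a = r"
    using ex_arc_to[OF r] .
  show False
  proof (rule subcritical_recurrence_impossible[of "real q" w "\<lambda>n. branch h n a"])
    show "branch h (n + 2) a + real q * branch h n a \<le> w * branch h (n + 1) a" for n
      using branch_green_Suc[OF h(2) a(1), of n] indicator_branch_nonneg[OF a(1), of r "n + 1"] w0
      by (smt (verit) mult_nonneg_nonneg)
  qed (use h a w q_pos in \<open>auto intro: branch_nonneg\<close>)
qed

lemma cycle_growth_le: "r \<in> verts G \<Longrightarrow> cycle_growth G r \<le> real q + 1"
  unfolding cycle_growth_def
  by (rule growth_rate_le[where K = 1]) (use num_cycles_le in auto)

lemma reduced_cycle_growth_le:
  assumes r: "r \<in> verts G" and s: "0 < s" "real q < s\<^sup>2" "cycle_growth G r < s + real q / s"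
  shows "reduced_cycle_growth G arev r \<le> s"
proof -
  define w where "w = s + real q / s"
  have w0: "0 < w" using s q_pos by (simp add: w_def add_pos_pos)
  obtain h where h: "\<And>v. v \<in> verts G \<Longrightarrow> 0 \<le> h v"
      "\<And>v. v \<in> verts G \<Longrightarrow> w * h v = w * indicator {r} v + adj h v" "0 < h r"
    using green_function_above_growth[OF r s(3)[folded w_def]] by blast
  \<comment> \<open>The index starts at radius 1, because the recursion has the factor
    \<open>q + 1\<close> at the centre.\<close>
  define x where "x n = sphere h (n + 1) r" for n
  define y where "y n = w * sphere (indicator {r}) (n + 2) r" for n
  have rec: "x (n + 2) + real q * x n + y n = (s + real q / s) * x (n + 1)" for n
  proof -
    have "x (n + 2) + real q * x n + y n = (\<Sum>a\<in>out_arcs G r.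
        branch h (n + 2) a + real q * branch h n a + w * branch (indicator {r}) (n + 1) a)"
      by (simp add: x_def y_def sum.distrib sum_distrib_left)
    also have "\<dots> = (\<Sum>a\<in>out_arcs G r. w * branch h (n + 1) a)"
      by (intro sum.cong refl branch_green_Suc h(2)) auto
    finally show ?thesis
      by (simp add: w_def x_def sum_distrib_left)
  qed
  have xy: "0 \<le> x n" "0 \<le> y n" for n
    unfolding x_def y_def using h(1) r w0
    by (intro sphere_nonneg mult_nonneg_nonneg; simp)+
  obtain K where K: "0 < K" "\<And>n. y n \<le> K * s ^ n"
    using recurrence_source_growth[OF _ s(1,2) xy rec] q_pos by (metis of_nat_0_less_iff)
  \<comment> \<open>The three summands serve \<open>n \<ge> 2\<close>, \<open>n = 0\<close> and
    \<open>n = 1\<close>; \<open>s\<^sup>2\<close> undoes the shift by 2 in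
    \<open>y\<close>.\<close>
  define K' where "K' = K / (w * s\<^sup>2) + 1 + (real q + 1) / s"
  have K': "0 < K'" "1 \<le> K'" "(real q + 1) / s \<le> K'" "K / (w * s\<^sup>2) \<le> K'"
    using K(1) w0 s(1) by (auto simp: K'_def add_nonneg_pos)
  have "real (num_reduced_cycles G arev r n) \<le> K' * s ^ n" for n
  proof -
    consider "n = 0" | "n = 1" | m where "n = m + 2"
      by (metis One_nat_def add_2_eq_Suc' old.nat.exhaust)
    then show ?thesis
    proof cases
      case 1
      then show ?thesis
        using num_reduced_cycles_le[OF r, of n] K'(2) by simp
    next
      case 2
      then show ?thesis
        using num_reduced_cycles_le[OF r, of n] K'(3) s(1) by (simp add: field_simps)
    next
      case 3
      have "w * real (num_reduced_cycles G arev r n) \<le> K * s ^ m"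
        using K(2)[of m] by (simp add: y_def num_reduced_cycles_eq[OF r] 3)
      then have "real (num_reduced_cycles G arev r n) \<le> K / (w * s\<^sup>2) * s ^ n"
        using w0 s(1) by (simp add: 3 field_simps power_add power2_eq_square)
      also have "\<dots> \<le> K' * s ^ n"
        using K'(4) s(1) by (intro mult_right_mono) auto
      finally show ?thesis .
    qed
  qed
  then show ?thesis
    unfolding reduced_cycle_growth_def using K'(1) s(1)
    by (intro growth_rate_le[where K = K']) auto
qed

text \<open>The sequence \<open>\<phi>\<close> below is a supersolution of the recursion for the spheres; at the index
  \<open>0\<close>, where the degree is \<open>q + 1\<close> instead of \<open>q\<close>, this uses \<open>s \<le> q\<close>.\<close>

lemma cycle_growth_le_of_reduced:
  assumes r: "r \<in> verts G" and s: "0 < s" "s \<le> real q" "reduced_cycle_growth G arev r < s"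
  shows "cycle_growth G r \<le> s + real q / s"
proof -
  define w where "w = s + real q / s"
  have w0: "0 < w" using s q_pos by (simp add: w_def add_pos_pos)
  \<comment> \<open>The value at 0 is chosen to give equality in the recursion at index 1.\<close>
  define \<phi> where "\<phi> m = (if m = 0 then real q / (real q + 1) else s ^ m)" for m
  obtain K where K: "0 < K" "\<And>n. real (num_reduced_cycles G arev r n) \<le> K * s ^ n"
    using growth_rate_lessD[of "num_reduced_cycles G arev r" s "real q + 1"] s(3)
      num_reduced_cycles_le[OF r]
    by (auto simp: reduced_cycle_growth_def)
  \<comment> \<open>The scaling gives \<open>K' * \<phi> 0 = K\<close>, since
    \<open>\<phi> 0 < 1\<close>.\<close>
  define K' where "K' = K * (real q + 1) / real q"
  have K': "0 < K'" "K \<le> K'"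
    using K(1) q_pos by (auto simp: K'_def field_simps add_pos_nonneg)
  have sw: "s * w = s\<^sup>2 + real q"
    using s(1) by (simp add: w_def field_simps power2_eq_square)
  have "s * \<phi> 1 \<le> s * (w * \<phi> 0)"
  proof -
    have "s\<^sup>2 \<le> (real q)\<^sup>2"
      using s by (intro power_mono) auto
    then have "s\<^sup>2 * (real q + 1) \<le> (s\<^sup>2 + real q) * real q"
      by (simp add: algebra_simps power2_eq_square)
    then have "s * s \<le> s * w * (real q / (real q + 1))"
      unfolding sw using q_pos by (simp add: field_simps power2_eq_square)
    then show ?thesis by (simp add: \<phi>_def)
  qed
  then have phi_0: "\<phi> 1 \<le> w * \<phi> 0" using s(1) by simp
  have phi_1: "\<phi> 2 + (real q + 1) * \<phi> 0 = w * \<phi> 1"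
    using sw q_pos by (simp add: \<phi>_def mult.commute)
  have phi_Suc: "\<phi> (m + 3) + real q * \<phi> (m + 1) = w * \<phi> (m + 2)" for m
  proof -
    have "w * \<phi> (m + 2) = s ^ (m + 1) * (s * w)"
      by (simp add: \<phi>_def)
    also have "\<dots> = \<phi> (m + 3) + real q * \<phi> (m + 1)"
      unfolding sw by (simp add: \<phi>_def algebra_simps power_add power2_eq_square power3_eq_cube)
    finally show ?thesis by simp
  qed
  \<comment> \<open>All radii \<open>m\<close> are needed in the induction; \<open>m = 0\<close>
    gives the numbers of cycles.\<close>
  have bound: "sphere ((adj ^^ n) (indicator {r})) m r \<le> K' * w ^ n * \<phi> m" for n m
  proof (induction n arbitrary: m)
    case 0
    show ?case
    proof (cases "m = 0")
      case True
      have "real (num_reduced_cycles G arev r 0) \<le> K"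
        using K(2)[of 0] by simp
      also have "K = K' * \<phi> 0"
        using q_pos by (simp add: K'_def \<phi>_def)
      finally show ?thesis
        by (simp add: True num_reduced_cycles_eq[OF r])
    next
      case False
      have "real (num_reduced_cycles G arev r m) \<le> K * s ^ m" by (rule K(2))
      also have "\<dots> \<le> K' * s ^ m"
        using K'(2) s(1) by (intro mult_right_mono) auto
      finally show ?thesis
        using False by (simp add: num_reduced_cycles_eq[OF r] \<phi>_def)
    qed
  next
    case (Suc n)
    let ?f = "(adj ^^ n) (indicator {r})"
    let ?c = "K' * w ^ n"
    have c: "0 \<le> ?c" using K' w0 by simp
    have "sphere (adj ?f) m r \<le> ?c * (w * \<phi> m)"
    proof -
      consider "m = 0" | "m = 1" | j where "m = j + 2"
        by (metis One_nat_def add_2_eq_Suc' old.nat.exhaust)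
      then show ?thesis
      proof cases
        case 1
        have "sphere (adj ?f) 0 r \<le> ?c * \<phi> 1"
          unfolding sphere_adj_0 by (rule Suc.IH)
        also have "\<dots> \<le> ?c * (w * \<phi> 0)"
          using phi_0 c by (rule mult_left_mono)
        finally show ?thesis by (simp only: 1)
      next
        case 2
        have "sphere (adj ?f) 1 r \<le> ?c * \<phi> 2 + (real q + 1) * (?c * \<phi> 0)"
          unfolding sphere_adj_1[OF r] using Suc.IH[of 2] Suc.IH[of 0]
          by (intro add_mono mult_left_mono) auto
        also have "\<dots> = ?c * (\<phi> 2 + (real q + 1) * \<phi> 0)"
          by (simp add: algebra_simps)
        finally show ?thesis by (simp only: 2 phi_1)
      next
        case 3
        have "sphere (adj ?f) (j + 2) r \<le> ?c * \<phi> (j + 3) + real q * (?c * \<phi> (j + 1))"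
          unfolding sphere_adj_Suc_Suc
          by (intro add_mono mult_left_mono Suc.IH) auto
        also have "\<dots> = ?c * (\<phi> (j + 3) + real q * \<phi> (j + 1))"
          by (simp add: algebra_simps)
        finally show ?thesis by (simp only: 3 phi_Suc)
      qed
    qed
    then show ?case by (simp add: mult_ac)
  qed
  have "real (num_cycles G r n) \<le> K' * \<phi> 0 * w ^ n" for n
    using bound[of n 0] by (simp add: num_cycles_eq[OF r] mult_ac)
  moreover have "0 < K' * \<phi> 0"
    using K'(1) q_pos by (simp add: \<phi>_def)
  ultimately show ?thesis
    unfolding cycle_growth_def w_def[symmetric] using w0
    by (intro growth_rate_le[where K = "K' * \<phi> 0"]) auto
qed

end

section \<open>Circuits\<close>

context regular_bidirected_digraph
begin

text \<open>A cyclically reduced closed walk: arcs may repeat, and the condition on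
  \<open>hd\<close> and \<open>last\<close> excludes a backtrack where two copies of
  \<open>p\<close> meet.\<close>

definition circuit_at :: "'a \<Rightarrow> 'b list \<Rightarrow> bool" where
  "circuit_at v p \<longleftrightarrow> awalk v p v \<and> p \<noteq> [] \<and> no_backtrack arev p \<and> hd p \<noteq> arev (last p)"

lemma awalk_reverse:
  "awalk u p v \<Longrightarrow> awalk v (rev (map arev p)) u"
proof (induction p arbitrary: u)
  case Nil
  then show ?case by (auto simp: awalk_Nil_iff)
next
  case (Cons e p)
  then have "awalk v (rev (map arev p)) (head G e)" "e \<in> arcs G" "tail G e = u"
    by (auto simp: awalk_Cons_iff)
  moreover from this have "awalk (head G e) [arev e] u"
    by (auto simp: awalk_Cons_iff awalk_Nil_iff)
  ultimately show ?case
    by (auto intro: awalk_appendI)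
qed

lemma no_backtrack_reverse: "no_backtrack arev p \<Longrightarrow> no_backtrack arev (rev (map arev p))"
  unfolding no_backtrack_successively successively_rev successively_map
  by (erule successively_mono) (metis arev_arev)

text \<open>If \<open>p\<close> starts with \<open>arev a\<close>, take its reversal.\<close>

lemma circuit_at_extends:
  assumes "circuit_at (head G a) p"
  obtains p' where "awalk (head G a) p' (head G a)" "length p' = length p"
    and "no_backtrack arev (a # p')"
proof (cases "hd p = arev a")
  case False
  with assms show ?thesis
    by (intro that[of p]) (auto simp: circuit_at_def no_backtrack_successively successively_Cons)
next
  case True
  have p: "awalk (head G a) p (head G a)" "p \<noteq> []" "no_backtrack arev p" "hd p \<noteq> arev (last p)"
    using assms by (auto simp: circuit_at_def)
  \<comment> \<open>Equality would mean \<open>last p = a\<close>, so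
    \<open>hd p = arev (last p)\<close>, which a circuit excludes.\<close>
  have "hd (rev (map arev p)) \<noteq> arev a"
    using p True by (auto simp: hd_rev last_map arev_eq_iff)
  then show ?thesis
    using awalk_reverse[OF p(1)] no_backtrack_reverse[OF p(3)]
    by (intro that[of "rev (map arev p)"]) (auto simp: no_backtrack_successively successively_Cons)
qed

lemma circuit_at_power:
  assumes p: "circuit_at v p"
  defines "c \<equiv> \<lambda>j. concat (replicate j p)"
  shows "awalk v (c j) v" "length (c j) = j * length p" "no_backtrack arev (c j)"
proof -
  have p': "awalk v p v" "p \<noteq> []" "no_backtrack arev p" "hd p \<noteq> arev (last p)"
    using p by (auto simp: circuit_at_def)
  show "awalk v (c j) v"
    by (induction j) (use p' in \<open>auto simp: c_def awalk_Nil_iff intro: awalk_appendI\<close>)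
  show "length (c j) = j * length p"
    by (induction j) (auto simp: c_def)
  have hd: "hd (c j) = hd p" if "c j \<noteq> []" for j
    using that p'(2) by (cases j) (auto simp: c_def)
  show "no_backtrack arev (c j)"
  proof (induction j)
    case (Suc j)
    have "c (Suc j) = p @ c j" by (simp add: c_def)
    then show ?case
      using Suc p' hd[of j]
      by (cases "c j = []") (simp_all add: no_backtrack_successively successively_append_iff)
  qed (simp add: c_def no_backtrack_def)
qed

lemma circuit_at_pos_length: "circuit_at v p \<Longrightarrow> 0 < length p"
  by (simp add: circuit_at_def)

text \<open>The powers of \<open>p\<close> give a reduced cycle for every multiple of
  \<open>length p\<close>, so the counts do not decay exponentially.\<close>

lemma reduced_cycle_growth_ge_1:
  assumes r: "r \<in> verts G" and p: "circuit_at r p"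
  shows "1 \<le> reduced_cycle_growth G arev r"
proof (rule ccontr)
  assume "\<not> ?thesis"
  then obtain w where w: "reduced_cycle_growth G arev r < w" "w < 1"
    using dense by (metis not_le)
  have w0: "0 < w"
    using w(1) growth_rate_nonneg[of "num_reduced_cycles G arev r"]
    by (simp add: reduced_cycle_growth_def)
  obtain K where K: "0 < K" "\<And>n. real (num_reduced_cycles G arev r n) \<le> K * w ^ n"
    using growth_rate_lessD[of "num_reduced_cycles G arev r" w "real q + 1"] w(1)
      num_reduced_cycles_le[OF r]
    by (auto simp: reduced_cycle_growth_def)
  obtain j where j: "w ^ j < 1 / K"
    using real_arch_pow_inv[of "1 / K" w] K(1) w(2) by auto
  let ?S = "{p' \<in> closed_walks G r (j * length p). no_backtrack arev p'}"
  have "finite ?S"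
    by (rule finite_subset[OF _ card_walks(1)[OF r, of r "j * length p"]])
      (auto simp: closed_walks_def)
  moreover have "concat (replicate j p) \<in> ?S"
    using circuit_at_power[OF p] by (simp add: closed_walks_def)
  ultimately have "1 \<le> num_reduced_cycles G arev r (j * length p)"
    unfolding num_reduced_cycles_def by (metis (no_types, lifting) One_nat_def Suc_leI card_gt_0_iff empty_iff)
  also have "real (num_reduced_cycles G arev r (j * length p)) \<le> K * w ^ (j * length p)"
    by (rule K(2))
  also have "\<dots> \<le> K * w ^ j"
    using K(1) w0 w(2) circuit_at_pos_length[OF p]
    by (intro mult_left_mono power_decreasing) (auto simp: Suc_leI)
  finally show False
    using j K(1) by (simp add: field_simps)
qed

text \<open>There are \<open>q ^ n\<close> extensions of \<open>a\<close>, and along each arc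
  \<open>h\<close> loses at most the factor \<open>s\<close>.\<close>

lemma branch_ge:
  assumes s: "0 < s" and h: "\<And>b. b \<in> arcs G \<Longrightarrow> h (tail G b) \<le> s * h (head G b)"
    and a: "a \<in> arcs G"
  shows "(real q / s) ^ n * h (head G a) \<le> branch h n a"
  using a
proof (induction n arbitrary: a)
  case (Suc n)
  have "(real q / s) ^ n * (h (head G a) / s) \<le> branch h n b" if b: "b \<in> continuations a" for b
  proof -
    have "h (head G a) / s \<le> h (head G b)"
      using h[of b] continuationsD[OF Suc.prems b] s by (simp add: field_simps)
    then have "(real q / s) ^ n * (h (head G a) / s) \<le> (real q / s) ^ n * h (head G b)"
      using s by (intro mult_left_mono) auto
    also have "\<dots> \<le> branch h n b"
      using Suc.IH continuationsD[OF Suc.prems b] by blast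
    finally show ?thesis .
  qed
  then have "(\<Sum>b\<in>continuations a. (real q / s) ^ n * (h (head G a) / s)) \<le> branch h (Suc n) a"
    unfolding branch.simps(2) by (rule sum_mono)
  then show ?case using Suc.prems by (simp add: mult_ac)
qed simp

text \<open>This refines \<open>branch_ge\<close>: for the one extension \<open>p\<close> the
  estimate \<open>(1 / s) ^ length p * h (head G a)\<close> is replaced by the true value
  \<open>h u\<close>.\<close>

lemma branch_ge_path:
  assumes s: "0 < s" and h: "\<And>b. b \<in> arcs G \<Longrightarrow> h (tail G b) \<le> s * h (head G b)"
    and a: "a \<in> arcs G" "awalk (head G a) p u" "no_backtrack arev (a # p)"
  shows "((real q / s) ^ length p - (1 / s) ^ length p) * h (head G a) + h u \<le> branch h (length p) a"
  using a
proof (induction p arbitrary: a)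
  case (Cons b p)
  define Q where "Q = real q / s"
  define H where "H = h (head G a) / s"
  have b: "b \<in> continuations a" "awalk (head G b) p u" "no_backtrack arev (b # p)"
    using Cons.prems
    by (auto simp: awalk_Cons_iff continuations_def no_backtrack_successively)
  have H: "H \<le> h (head G c)" if "c \<in> continuations a" for c
    using h[of c] continuationsD[OF Cons.prems(1) that] s by (simp add: H_def field_simps)
  \<comment> \<open>The coefficient in the induction hypothesis is thus nonnegative, and
    \<open>H\<close> may replace \<open>h (head G b)\<close>.\<close>
  have "(1 / s) ^ length p \<le> Q ^ length p"
    using s q_pos by (intro power_mono) (auto simp: Q_def divide_right_mono)
  then have "(Q ^ length p - (1 / s) ^ length p) * H + h u
      \<le> (Q ^ length p - (1 / s) ^ length p) * h (head G b) + h u"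
    using H[OF b(1)] by (intro add_right_mono mult_left_mono) auto
  also have "\<dots> \<le> branch h (length p) b"
    using Cons.IH[of b] b continuationsD[OF Cons.prems(1) b(1)] by (simp add: Q_def)
  finally have 1: "(Q ^ length p - (1 / s) ^ length p) * H + h u \<le> branch h (length p) b" .
  have "Q ^ length p * H \<le> branch h (length p) c" if c: "c \<in> continuations a - {b}" for c
  proof -
    have "Q ^ length p * H \<le> Q ^ length p * h (head G c)"
      using H[of c] c s by (intro mult_left_mono) (auto simp: Q_def)
    also have "\<dots> \<le> branch h (length p) c"
      unfolding Q_def using c continuationsD[OF Cons.prems(1), of c]
      by (intro branch_ge[OF s h]) auto
    finally show ?thesis .
  qed
  then have "(\<Sum>c\<in>continuations a - {b}. Q ^ length p * H)
      \<le> (\<Sum>c\<in>continuations a - {b}. branch h (length p) c)"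
    by (rule sum_mono)
  moreover have "card (continuations a - {b}) = q - 1"
    using b(1) Cons.prems(1) by simp
  ultimately have 2: "(real q - 1) * (Q ^ length p * H)
      \<le> (\<Sum>c\<in>continuations a - {b}. branch h (length p) c)"
    using q_pos by (simp add: of_nat_diff)
  have "branch h (length (b # p)) a
      = branch h (length p) b + (\<Sum>c\<in>continuations a - {b}. branch h (length p) c)"
    using b(1) Cons.prems(1) by (simp add: sum.remove)
  with 1 2 have "(Q ^ length p - (1 / s) ^ length p) * H + h u + (real q - 1) * (Q ^ length p * H)
      \<le> branch h (length (b # p)) a"
    by linarith
  moreover have "(Q ^ length p - (1 / s) ^ length p) * H + h u + (real q - 1) * (Q ^ length p * H)
      = (Q ^ length (b # p) - (1 / s) ^ length (b # p)) * h (head G a) + h u"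
    using s by (simp add: H_def Q_def field_simps)
  ultimately show ?case by (simp add: Q_def)
qed (auto simp: awalk_Nil_iff)

text \<open>Applying \<open>step\<close> at the last arc of every extension gains the factor
  \<open>\<mu>\<close> in each block of \<open>L\<close> steps.\<close>

lemma branch_iterate:
  assumes \<mu>: "0 \<le> \<mu>" and step: "\<And>a. a \<in> arcs G \<Longrightarrow> \<mu> * h (head G a) \<le> branch h L a"
    and a: "a \<in> arcs G"
  shows "\<mu> ^ j * h (head G a) \<le> branch h (j * L) a"
proof (induction j)
  case (Suc j)
  have *: "\<mu> * branch h n a \<le> branch h (n + L) a" if "a \<in> arcs G" for n a
    using that
  proof (induction n arbitrary: a)
    case (Suc n)
    have "\<mu> * branch h (Suc n) a = (\<Sum>b\<in>continuations a. \<mu> * branch h n b)"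
      by (simp add: sum_distrib_left)
    also have "\<dots> \<le> (\<Sum>b\<in>continuations a. branch h (n + L) b)"
      using Suc by (intro sum_mono) (auto dest: continuationsD)
    finally show ?case by simp
  qed (use step in simp)
  have "\<mu> ^ Suc j * h (head G a) = \<mu> * (\<mu> ^ j * h (head G a))" by simp
  also have "\<dots> \<le> \<mu> * branch h (j * L) a"
    using Suc \<mu> by (rule mult_left_mono)
  also have "\<dots> \<le> branch h (j * L + L) a" by (rule *[OF a])
  finally show ?case by (simp add: add.commute)
qed simp

text \<open>If the cycle growth were at most \<open>2 * sqrt q\<close>, then there would be a Green function at
  \<open>s + q / s\<close> for every \<open>s > sqrt q\<close>, and its branch sums would be \<open>O(s ^ n)\<close>. Along an arc it
  loses at most the factor \<open>s\<close>, but going round a circuit it does not lose anything; for \<open>s\<close> close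
  to \<open>sqrt q\<close> the gain makes the branch sums grow by more than \<open>s ^ L\<close> in \<open>L\<close> steps.\<close>

lemma cycle_growth_gt_of_circuits:
  assumes r: "r \<in> verts G" and q: "2 \<le> q" and L: "0 < L"
    and circuits: "\<And>v. v \<in> verts G \<Longrightarrow> \<exists>p. circuit_at v p \<and> length p = L"
  shows "2 * sqrt (real q) < cycle_growth G r"
proof (rule ccontr)
  assume "\<not> ?thesis"
  then have le: "cycle_growth G r \<le> 2 * sqrt (real q)" by simp
  \<comment> \<open>The factor from \<open>branch_ge_path\<close> for a closed extension of length
    \<open>L\<close>, where \<open>u = head G a\<close>.\<close>
  define \<mu> where "\<mu> s = (real q / s) ^ L - (1 / s) ^ L + 1" for s :: real
  define z where "z = sqrt (real q)"
  have z: "1 < z" "real q = z * z" using q by (auto simp: z_def)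
  have "((\<lambda>s. \<mu> s - s ^ L) \<longlongrightarrow> \<mu> z - z ^ L) (at_right z)"
    unfolding \<mu>_def using z by (intro tendsto_intros) auto
  \<comment> \<open>At \<open>z = sqrt q\<close> the terms \<open>(q / z) ^ L\<close> and
    \<open>z ^ L\<close> cancel and \<open>1 - (1 / z) ^ L\<close> remains, positive as
    \<open>q \<ge> 2\<close>. By continuity the gain persists for \<open>s\<close> slightly above
    \<open>z\<close>.\<close>
  moreover have "0 < \<mu> z - z ^ L"
  proof -
    have "(1 / z) ^ L < 1 ^ L"
      using z L by (intro power_strict_mono) auto
    moreover have "real q / z = z" using z by simp
    ultimately show ?thesis by (simp add: \<mu>_def)
  qed
  ultimately have "\<forall>\<^sub>F s in at_right z. 0 < \<mu> s - s ^ L"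
    by (rule order_tendstoD)
  then obtain b where "z < b" "\<And>s. z < s \<Longrightarrow> s < b \<Longrightarrow> 0 < \<mu> s - s ^ L"
    unfolding eventually_at_right_field by blast
  moreover obtain s where "z < s" "s < b"
    using dense[OF \<open>z < b\<close>] by blast
  ultimately have s: "z < s" "s ^ L < \<mu> s" by auto
  have s0: "0 < s" "real q < s\<^sup>2"
    using s z by (auto simp: power2_eq_square intro: mult_strict_mono)
  define w where "w = s + real q / s"
  have "0 < (s - z)\<^sup>2" using s by simp
  then have "2 * z * s < s\<^sup>2 + real q"
    using z(2) by (simp add: power2_eq_square algebra_simps)
  then have w: "2 * z < w"
    using s0 by (simp add: w_def field_simps power2_eq_square)
  then have w0: "0 < w" using z by simp
  have "cycle_growth G r < w" using le w by (simp add: z_def)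
  then obtain h where h: "\<And>v. v \<in> verts G \<Longrightarrow> 0 \<le> h v"
      "\<And>v. v \<in> verts G \<Longrightarrow> w * h v = w * indicator {r} v + adj h v" "0 < h r"
    using green_function_above_growth[OF r] by blast
  have rec: "branch h (n + 2) a + real q * branch h n a + w * branch (indicator {r}) (n + 1) a
      = (s + real q / s) * branch h (n + 1) a" if "a \<in> arcs G" for a n
    using branch_green_Suc[OF h(2) that] by (simp add: w_def)
  have nonneg: "0 \<le> branch h n a" "0 \<le> w * branch (indicator {r}) (n + 1) a"
    if "a \<in> arcs G" for a n
    using that h(1) w0 by (auto intro!: mult_nonneg_nonneg branch_nonneg simp del: branch.simps)
  \<comment> \<open>Bounding \<open>branch h 1 a\<close> from below by the nonnegative defect at
    index 0 leaves the factor \<open>s\<close> in the Green equation at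
    \<open>head G a\<close>.\<close>
  have harnack: "h (tail G a) \<le> s * h (head G a)" if a: "a \<in> arcs G" for a
  proof -
    have "real q / s * branch h 0 a \<le> branch h (0 + 1) a"
      using recurrence_defect_nonneg[of "real q" s "\<lambda>n. branch h n a"
          "\<lambda>n. w * branch (indicator {r}) (n + 1) a" 0] q s0 nonneg[OF a] rec[OF a]
      by simp
    then have "real q / s * h (head G a) \<le> branch h 1 a" by simp
    moreover have "branch h 1 a + h (tail G a) \<le> (s + real q / s) * h (head G a)"
    proof -
      have "0 \<le> w * indicator {r} (head G a)" using w0 by (simp add: indicator_def)
      with branch_green_0[OF h(2) a] show ?thesis unfolding w_def by linarith
    qed
    ultimately show ?thesis by (simp add: algebra_simps)
  qed
  have gain: "\<mu> s * h (head G a) \<le> branch h L a" if a: "a \<in> arcs G" for a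
  proof -
    obtain p where "circuit_at (head G a) p" "length p = L"
      using circuits[of "head G a"] a by auto
    then obtain p' where p': "awalk (head G a) p' (head G a)" "length p' = L"
        "no_backtrack arev (a # p')"
      using circuit_at_extends by metis
    then show ?thesis
      using branch_ge_path[OF s0(1) harnack a p'(1,3)] by (simp add: \<mu>_def algebra_simps)
  qed
  obtain a where a: "a \<in> arcs G" "head G a = r"
    using ex_arc_to[OF r] .
  obtain K where K: "\<And>n. branch h n a \<le> K * s ^ n"
    using recurrence_growth[OF _ s0 nonneg[OF a(1)] rec[OF a(1)]] q_pos of_nat_0_less_iff by blast
  have sL: "0 < s ^ L" using s0 by simp
  then have "1 < \<mu> s / s ^ L" using s by simp
  \<comment> \<open>After \<open>j * L\<close> steps the lower bound
    \<open>\<mu> s ^ j * h r\<close> exceeds the upper bound \<open>K * s ^ (j * L)\<close>.\<close>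
  then obtain j where j: "K < h r * (\<mu> s / s ^ L) ^ j"
    using power_dominates h(3) by blast
  have "\<mu> s ^ j * h r \<le> K * s ^ (j * L)"
    using branch_iterate[of "\<mu> s" h L a j] gain a sL s K[of "j * L"] by force
  then have "h r * (\<mu> s / s ^ L) ^ j \<le> K"
    using s0(1) by (simp add: power_divide power_mult[symmetric] mult.commute pos_divide_le_eq)
  with j show False by simp
qed

text \<open>Automorphisms commute with \<open>arev\<close> and are injective on arcs, so the image
  of \<open>p\<close> again contains no arc together with its reverse; this excludes backtracks,
  cyclically too.\<close>

lemma circuit_at_translate:
  assumes h: "graph_automorphism G arev f" and p: "awalk v p v" "p \<noteq> []" "\<forall>a\<in>set p. arev a \<notin> set p"
  shows "circuit_at (iso_verts f v) (map (iso_arcs f) p)"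
proof -
  have f: "digraph_isomorphism f" "app_iso f G = G"
      "\<And>a. a \<in> arcs G \<Longrightarrow> iso_arcs f (arev a) = arev (iso_arcs f a)"
    using h by (auto simp: graph_automorphism_def)
  have inj: "inj_on (iso_arcs f) (arcs G)"
    using f(1) by (simp add: digraph_isomorphism_def)
  have sub: "set p \<subseteq> arcs G" using p(1) by auto
  have disj: "iso_arcs f b \<noteq> arev (iso_arcs f a)" if "a \<in> set p" "b \<in> set p" for a b
  proof
    assume "iso_arcs f b = arev (iso_arcs f a)"
    then have "iso_arcs f b = iso_arcs f (arev a)" using f(3) that sub by auto
    then have "b = arev a" using inj that sub by (auto dest!: inj_onD)
    with p(3) that show False by blast
  qed
  have "no_backtrack arev (map (iso_arcs f) p)"
    unfolding no_backtrack_def using disj by auto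
  moreover have "hd (map (iso_arcs f) p) \<noteq> arev (last (map (iso_arcs f) p))"
    using p(2) disj by (simp add: hd_map last_map)
  ultimately show ?thesis
    using awalk_app_isoI[OF p(1) f(1)] p(2) by (simp add: circuit_at_def f(2))
qed

text \<open>With connectedness settled, a component that is not a tree must contain a
  circuit.\<close>

lemma component_of_connected:
  assumes "v \<in> verts G"
  shows "Digraph_Component.connected (component_of G v)"
proof -
  have "component_of G v \<in> sccs"
    unfolding component_of_def by (rule induce_reachable_is_in_sccs[OF assms])
  then have sc: "strongly_connected (component_of G v)" and "induced_subgraph (component_of G v) G"
    by auto
  then interpret C: wf_digraph "component_of G v" by auto
  show ?thesis
    using sc unfolding strongly_connected_def
    by (intro C.connectedI) (auto intro: C.reachable_mk_symmetricI)
qed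

text \<open>Automorphisms carry one circuit of the component to every vertex and preserve its
  length.\<close>

lemma vertex_transitive_circuits:
  assumes vt: "vertex_transitive G arev" and r: "r \<in> verts G"
    and not_tree: "\<not> undirected_tree (component_of G r) arev"
  obtains L where "0 < L" "\<And>v. v \<in> verts G \<Longrightarrow> \<exists>p. circuit_at v p \<and> length p = L"
proof -
  obtain p where "circuit (component_of G r) arev p"
    using not_tree component_of_connected[OF r] by (auto simp: undirected_tree_def)
  moreover have "subgraph (component_of G r) G"
    using induce_reachable_is_in_sccs[OF r] unfolding component_of_def by auto
  ultimately have "cycle p" "\<forall>a\<in>set p. arev a \<notin> set p"
    using subgraph_cycle by (auto simp: circuit_def)
  then obtain u where u: "awalk u p u" "p \<noteq> []" "\<forall>a\<in>set p. arev a \<notin> set p"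
    by (auto simp: cycle_def)
  have "\<exists>p'. circuit_at v p' \<and> length p' = length p" if v: "v \<in> verts G" for v
  proof -
    have "u \<in> verts G" using u(1) by auto
    then obtain f where "graph_automorphism G arev f" "iso_verts f u = v"
      using vt v unfolding vertex_transitive_def by blast
    with circuit_at_translate[OF _ u] show ?thesis
      by (metis length_map)
  qed
  with u(2) show ?thesis by (intro that[of "length p"]) auto
qed

end

section \<open>The larger root of the quadratic equation and the conclusion\<close>

lemma larger_root_properties:
  fixes \<rho> q \<alpha> :: real
  assumes q: "1 \<le> q" and \<rho>: "2 * sqrt q \<le> \<rho>"
  defines "\<alpha> \<equiv> (\<rho> + sqrt (\<rho>\<^sup>2 - 4 * q)) / 2"
  shows "0 \<le> \<rho>\<^sup>2 - 4 * q" "\<rho> / 2 \<le> \<alpha>"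
    and "\<alpha>\<^sup>2 - \<rho> * \<alpha> + q = 0"
    and "\<rho> \<le> q + 1 \<Longrightarrow> \<alpha> \<le> q"
proof -
  have "(2 * sqrt q)\<^sup>2 \<le> \<rho>\<^sup>2"
    using \<rho> q by (intro power_mono) auto
  then show disc: "0 \<le> \<rho>\<^sup>2 - 4 * q" using q by (simp add: power_mult_distrib)
  then show "\<rho> / 2 \<le> \<alpha>" by (simp add: \<alpha>_def)
  have "(sqrt (\<rho>\<^sup>2 - 4 * q))\<^sup>2 = \<rho>\<^sup>2 - 4 * q" using disc by simp
  then show "\<alpha>\<^sup>2 - \<rho> * \<alpha> + q = 0"
    by (simp add: \<alpha>_def power2_eq_square field_simps)
  assume le: "\<rho> \<le> q + 1"
  have "0 \<le> \<rho>" using \<rho> q by (meson order_trans mult_nonneg_nonneg real_sqrt_ge_zero zero_le_numeral zero_le_one)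
  then have "\<rho>\<^sup>2 \<le> (q + 1)\<^sup>2" using le by (intro power_mono)
  \<comment> \<open>This rests on \<open>(q + 1)\<^sup>2 - 4 * q = (q - 1)\<^sup>2\<close>.\<close>
  then have "\<rho>\<^sup>2 - 4 * q \<le> (q - 1)\<^sup>2"
    by (simp add: power2_eq_square algebra_simps)
  then have "sqrt (\<rho>\<^sup>2 - 4 * q) \<le> q - 1"
    using q by (intro real_le_lsqrt) auto
  with le show "\<alpha> \<le> q" by (simp add: \<alpha>_def)
qed

context regular_bidirected_digraph
begin

context
  fixes r :: 'a and \<rho> \<alpha> :: real
  assumes r: "r \<in> verts G"
  defines "\<rho> \<equiv> cycle_growth G r"
  defines "\<alpha> \<equiv> (\<rho> + sqrt (\<rho>\<^sup>2 - 4 * real q)) / 2"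
begin

lemma larger_root:
  shows "0 \<le> \<rho>\<^sup>2 - 4 * real q" "\<rho> / 2 \<le> \<alpha>" "sqrt (real q) \<le> \<alpha>" "\<alpha> \<le> real q"
    and "s\<^sup>2 - \<rho> * s + real q = (s - \<alpha>) * (s + \<alpha> - \<rho>)"
proof -
  have q: "1 \<le> real q" using q_pos by simp
  have \<rho>: "2 * sqrt (real q) \<le> \<rho>" "\<rho> \<le> real q + 1"
    unfolding \<rho>_def by (rule cycle_growth_ge[OF r], rule cycle_growth_le[OF r])
  note props = larger_root_properties[OF q \<rho>(1), folded \<alpha>_def]
  show "0 \<le> \<rho>\<^sup>2 - 4 * real q" "\<rho> / 2 \<le> \<alpha>" "\<alpha> \<le> real q"
    using props \<rho>(2) by auto
  show "sqrt (real q) \<le> \<alpha>" using \<rho>(1) props(2) by simp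
  show "s\<^sup>2 - \<rho> * s + real q = (s - \<alpha>) * (s + \<alpha> - \<rho>)"
    using props(3) by (simp add: power2_eq_square algebra_simps)
qed

text \<open>For \<open>s > \<alpha>\<close> the quadratic is positive, that is
  \<open>\<rho> < s + q / s\<close>, and \<open>reduced_cycle_growth_le\<close> applies; then
  \<open>s\<close> tends to \<open>\<alpha>\<close>.\<close>

lemma reduced_cycle_growth_upper: "reduced_cycle_growth G arev r \<le> \<alpha>"
proof (rule dense_ge)
  fix s assume s: "\<alpha> < s"
  have "0 < sqrt (real q)" using q_pos by simp
  with s larger_root(3) have s0: "0 < s" "sqrt (real q) < s" by linarith+
  have "0 < (s - \<alpha>) * (s + \<alpha> - \<rho>)"
    using s larger_root(2) by (intro mult_pos_pos) auto
  then have "\<rho> * s < s\<^sup>2 + real q"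
    using larger_root(5)[of s] by linarith
  then have "\<rho> < s + real q / s"
    using s0 by (simp add: field_simps power2_eq_square)
  moreover have "(sqrt (real q))\<^sup>2 < s\<^sup>2"
    using s0(2) by (intro power_strict_mono) auto
  then have "real q < s\<^sup>2" by simp
  ultimately show "reduced_cycle_growth G arev r \<le> s"
    using s0(1) unfolding \<rho>_def by (intro reduced_cycle_growth_le[OF r])
qed

text \<open>The roots \<open>\<rho> - \<alpha>\<close> and \<open>\<alpha>\<close> are distinct. If
  the reduced growth were below \<open>\<alpha>\<close>, some \<open>s\<close> above it would lie
  between them, where \<open>s + q / s < \<rho>\<close>, against
  \<open>cycle_growth_le_of_reduced\<close>.\<close>

lemma reduced_cycle_growth_supercritical:
  assumes "2 * sqrt (real q) < \<rho>"
  shows "reduced_cycle_growth G arev r = \<alpha>"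
proof (rule antisym[OF reduced_cycle_growth_upper], rule ccontr)
  assume "\<not> \<alpha> \<le> reduced_cycle_growth G arev r"
  moreover have "\<rho> - \<alpha> < \<alpha>" "sqrt (real q) < \<alpha>"
  proof -
    show "sqrt (real q) < \<alpha>" using assms larger_root(2) by simp
    have "0 < \<rho>\<^sup>2 - 4 * real q"
    proof -
      have "(2 * sqrt (real q))\<^sup>2 < \<rho>\<^sup>2"
        using assms by (intro power_strict_mono) auto
      then show ?thesis by (simp add: power_mult_distrib)
    qed
    then show "\<rho> - \<alpha> < \<alpha>" by (simp add: \<alpha>_def field_simps)
  qed
  ultimately obtain s where s: "max (reduced_cycle_growth G arev r) (max (\<rho> - \<alpha>) (sqrt (real q))) < s"
      "s < \<alpha>"
    using dense[of "max (reduced_cycle_growth G arev r) (max (\<rho> - \<alpha>) (sqrt (real q)))" \<alpha>] by auto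
  have "0 \<le> sqrt (real q)" by simp
  with s have s0: "0 < s" by linarith
  have "\<rho> \<le> s + real q / s"
    unfolding \<rho>_def using s s0 larger_root(4) by (intro cycle_growth_le_of_reduced[OF r]) auto
  then have "0 \<le> s\<^sup>2 - \<rho> * s + real q"
    using s0 by (simp add: field_simps power2_eq_square)
  moreover have "(s - \<alpha>) * (s + \<alpha> - \<rho>) < 0"
    using s by (intro mult_neg_pos) auto
  ultimately show False
    using larger_root(5)[of s] by linarith
qed

text \<open>For \<open>q = 1\<close> the bound \<open>\<rho> \<le> q + 1\<close> rules out strict
  inequality; there \<open>\<alpha> \<le> 1\<close>, and the powers of a circuit give growth at
  least 1.\<close>

lemma vertex_transitive_growth:
  assumes "vertex_transitive G arev" "\<not> undirected_tree (component_of G r) arev"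
  shows "2 \<le> q \<longrightarrow> 2 * sqrt (real q) < \<rho>" and "reduced_cycle_growth G arev r = \<alpha>"
proof -
  obtain L where L: "0 < L" "\<And>v. v \<in> verts G \<Longrightarrow> \<exists>p. circuit_at v p \<and> length p = L"
    using vertex_transitive_circuits[OF assms(1) r assms(2)] by blast
  show strict: "2 \<le> q \<longrightarrow> 2 * sqrt (real q) < \<rho>"
    using cycle_growth_gt_of_circuits[OF r _ L] by (simp add: \<rho>_def)
  show "reduced_cycle_growth G arev r = \<alpha>"
  proof (cases "2 \<le> q")
    case True
    with strict show ?thesis by (simp add: reduced_cycle_growth_supercritical)
  next
    case False
    then have "q = 1" using q_pos by simp
    then have "\<alpha> \<le> 1" using larger_root(4) by simp
    moreover have "1 \<le> reduced_cycle_growth G arev r"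
      using L(2)[OF r] reduced_cycle_growth_ge_1[OF r] by blast
    ultimately show ?thesis using reduced_cycle_growth_upper by linarith
  qed
qed

end

end

text \<open>The strict inequality is restricted to \<open>k \<ge> 3\<close> because a finite cycle
  has \<open>\<rho> = 2 = 2 * sqrt (k - 1)\<close>; the identity includes \<open>k = 2\<close>. The
  sign of the discriminant is asserted because \<open>sqrt\<close> is total.\<close>

theorem theorem2p5p1:
  fixes G :: "('a, 'b) pre_digraph" and arev :: "'b \<Rightarrow> 'b" and v0 :: 'a
    and k :: nat and \<rho> \<gamma> :: real
  assumes "bidirected_digraph G arev"
    and "k \<ge> 2"
    and "regular_graph G k"
    and "v0 \<in> verts G"
    and "\<rho> = cycle_growth G v0"
    and "\<gamma> = reduced_cycle_growth G arev v0"
  shows "(\<rho>\<^sup>2 - 4 * (real k - 1) \<ge> 0 \<and>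
          \<gamma> \<le> (\<rho> + sqrt (\<rho>\<^sup>2 - 4 * (real k - 1))) / 2) \<and>
         (\<rho> > 2 * sqrt (real k - 1) \<longrightarrow>
          \<gamma> = (\<rho> + sqrt (\<rho>\<^sup>2 - 4 * (real k - 1))) / 2) \<and>
         (vertex_transitive G arev \<and> simple_graph G \<and> \<not> undirected_tree (component_of G v0) arev \<longrightarrow>
          (k \<ge> 3 \<longrightarrow> \<rho> > 2 * sqrt (real k - 1)) \<and>
          \<gamma> = (\<rho> + sqrt (\<rho>\<^sup>2 - 4 * (real k - 1))) / 2)"
proof -
  interpret bidirected_digraph G arev by fact
  interpret regular_bidirected_digraph G arev "k - 1"
    using assms(2,3) by unfold_locales (auto simp: regular_graph_def out_degree_def)
  have k: "real (k - 1) = real k - 1" and k3: "2 \<le> k - 1 \<longleftrightarrow> 3 \<le> k"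
    using assms(2) by auto
  note root = larger_root(1)[OF assms(4)]
    and upper = reduced_cycle_growth_upper[OF assms(4)]
    and super = reduced_cycle_growth_supercritical[OF assms(4)]
    and transitive = vertex_transitive_growth[OF assms(4)]
  show ?thesis
    using root upper super transitive unfolding k k3 assms(5,6) by blast
qed

end
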